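(* Let $X$ and $Y$ be $R^+$-spaces, and let $P\subseteq(R^+)^{|X|}$ and $Q\subseteq (R^+)^{|Y|}$ be coverings such that $P^{\perp\perp}=P(X)$ and $Q^\perp=P(Y)$. Then for every $s\in(R^+)^{|X|\times|Y|}$ the following are equivalent: (1) $s\in P(X\multimap Y)$; (2) $s\in(P\otimes Q)^\perp$; (3) for all $x\in P$, $s\cdot x$ is defined and belongs to $P(Y)$; (4) for all $y'\in Q$, $s^\perp\cdot y'$ is defined and belongs to $P(X)^\perp$, where $(s^\perp)_{b,a}=s_{a,b}$.
   Context: PCM: a nonempty set with a partial sum $\Sigma$ on countably indexed families ("summable" families) satisfying (Unary) singletons $(x)$ are summable with sum $x$, and (WPA) for summable $(x_a)_{a\in A}$ and a countable partition $\{A_i\}_{i\in I}$ of $A$ (parts possibly empty), each $(x_a)_{a\in A_i}$ is summable and $(\sum_{a\in A_i}x_a)_i$ is summable with sum $\sum_{a\in A}x_a$; strong if also (PA): if each $(x_a)_{a\in A_i}$ and $(\sum_{a\in A_i}x_a)_i$ are summable then $(x_a)_{a\in A}$ is summable. $0$ is the empty sum; $x\le y$ iff $x+z=y$ for some $z$. A PCR $(R,\Sigma,1,\cdot)$ is a PCM with a commutative monoid $(R,1,\cdot)$ such that for summable $(x_a),(y_b)$, $(x_ay_b)_{(a,b)}$ is summable with sum $(\sum x_a)(\sum y_b)$; strong if its PCM is strong. Setting: $R^+$ a strong PCR, $\mathcal B\subseteq R^+$ downward closed. Webs are countable sets. $\langle x,y\rangle=\sum_a x_ay_a$ (partial); $x\perp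 y$ iff $\langle x,y\rangle$ is defined and in $\mathcal B$; $F^\perp=\{y\mid\forall x\in F, x\perp y\}$. A covering of $(R^+)^W$ is $F$ such that every $a\in W$ has some $x\in F$ with $x_a$ invertible. An $R^+$-space is $X=(|X|,P(X))$ with $P(X)\subseteq(R^+)^{|X|}$, $P(X)^{\perp\perp}=P(X)$, and $P(X)$, $P(X)^\perp$ coverings; $X^\perp=(|X|,P(X)^\perp)$. $(x\otimes y)_{a,b}=x_ay_b$, $F\otimes G=\{x\otimes y\mid x\in F,y\in G\}$, $X\otimes Y=(|X|\times|Y|,(P(X)\otimes P(Y))^{\perp\perp})$, $X\multimap Y=(X\otimes Y^\perp)^\perp$. $(s\cdot x)_b=\sum_a s_{a,b}x_a$, $(s^\perp\cdot y)_a=\sum_b s_{a,b}y_b$ (defined when all component sums are). *)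

theory Defs
  imports Main "HOL-Library.Countable_Set" "HOL-Library.Disjoint_Sets" "HOL-Library.FuncSet"
begin

text \<open>
  A family \<open>(x\<^sub>a)\<close> indexed by \<open>A\<close> is given by the set \<open>A\<close> and a function of which only the values
  on \<open>A\<close> matter. A type class cannot quantify over index types, so the primitive sum is on families
  indexed by sets of natural numbers; \<open>psum\<close> below transports it to arbitrary countable index sets.
  Nothing is lost: invariance under reindexing follows from the unary and partition axioms
  (\<open>psum_reindex\<close>), and the axioms carry over to all countable index sets
  (\<open>psum_unary\<close>, \<open>psum_wpa\<close>, \<open>psum_pa\<close>, \<open>psum_times\<close>).
\<close>

class pcm =
  fixes nat_psum :: "nat set \<Rightarrow> (nat \<Rightarrow> 'a) \<Rightarrow> 'a option"
  assumes nat_psum_cong: "(\<And>n. n \<in> A \<Longrightarrow> x n = y n) \<Longrightarrow> nat_psum A x = nat_psum A y"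
    and nat_psum_unary: "nat_psum {n} x = Some (x n)"
    and nat_psum_wpa: "nat_psum A x = Some s \<Longrightarrow> disjoint_family_on D I \<Longrightarrow> (\<Union>i\<in>I. D i) = A \<Longrightarrow>
      \<exists>t. (\<forall>i\<in>I. nat_psum (D i) x = Some (t i)) \<and> nat_psum I t = Some s"
begin

definition psum :: "'i set \<Rightarrow> ('i \<Rightarrow> 'a) \<Rightarrow> 'a option" where
  "psum A x = (if countable A then nat_psum (to_nat_on A ` A) (\<lambda>n. x (from_nat_into A n)) else None)"

text \<open>The binary sum \<open>x + z\<close> is the sum of a family indexed by the two Booleans.\<close>

definition pcm_le :: "'a \<Rightarrow> 'a \<Rightarrow> bool" where
  "pcm_le x y \<longleftrightarrow> (\<exists>z. psum UNIV (\<lambda>c. if c then x else z) = Some y)"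

definition down_closed :: "'a set \<Rightarrow> bool" where
  "down_closed B \<longleftrightarrow> (\<forall>x y. y \<in> B \<longrightarrow> pcm_le x y \<longrightarrow> x \<in> B)"

end

class strong_pcm = pcm +
  assumes nat_psum_pa: "disjoint_family_on D I \<Longrightarrow> (\<forall>i\<in>I. nat_psum (D i) x = Some (t i)) \<Longrightarrow>
      nat_psum I t \<noteq> None \<Longrightarrow> nat_psum (\<Union>i\<in>I. D i) x \<noteq> None"

class pcr = pcm + comm_monoid_mult +
  assumes nat_psum_times: "nat_psum A x = Some s \<Longrightarrow> nat_psum B y = Some t \<Longrightarrow>
      psum (A \<times> B) (\<lambda>(a, b). x a * y b) = Some (s * t)"

class strong_pcr = pcr + strong_pcm

lemma nat_psum_reindex1:
  fixes x :: "nat \<Rightarrow> 'r::pcm"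
  assumes "inj_on f A" "nat_psum (f ` A) x = Some s"
  shows "nat_psum A (\<lambda>a. x (f a)) = Some s"
proof -
  have "disjoint_family_on (\<lambda>a. {f a}) A"
    using assms(1) by (auto simp: disjoint_family_on_def inj_on_def)
  moreover have "(\<Union>a\<in>A. {f a}) = f ` A" by auto
  ultimately obtain t where t: "\<forall>a\<in>A. nat_psum {f a} x = Some (t a)" "nat_psum A t = Some s"
    using nat_psum_wpa[OF assms(2)] by blast
  have "nat_psum A (\<lambda>a. x (f a)) = nat_psum A t"
    using t(1) by (intro nat_psum_cong) (simp add: nat_psum_unary)
  then show ?thesis using t(2) by simp
qed

lemma nat_psum_reindex:
  fixes x :: "nat \<Rightarrow> 'r::pcm"
  assumes "inj_on f A"
  shows "nat_psum (f ` A) x = nat_psum A (\<lambda>a. x (f a))"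
proof -
  let ?g = "inv_into A f"
  have converse: "nat_psum (f ` A) x = Some s" if "nat_psum A (\<lambda>a. x (f a)) = Some s" for s
  proof -
    have "?g ` f ` A = A" using assms by (simp add: image_image)
    then have "nat_psum (f ` A) (\<lambda>b. x (f (?g b))) = Some s"
      using nat_psum_reindex1[OF inj_on_inv_into[of "f ` A" f A], of "\<lambda>a. x (f a)" s] that by simp
    moreover have "nat_psum (f ` A) (\<lambda>b. x (f (?g b))) = nat_psum (f ` A) x"
      by (intro nat_psum_cong) (simp add: f_inv_into_f)
    ultimately show ?thesis by simp
  qed
  show ?thesis
    by (cases "nat_psum (f ` A) x"; cases "nat_psum A (\<lambda>a. x (f a))")
       (auto dest: converse nat_psum_reindex1[OF assms])
qed

lemma psum_inj:
  fixes x :: "'i \<Rightarrow> 'r::pcm" and e :: "'i \<Rightarrow> nat"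
  assumes "inj_on e A"
  shows "psum A x = nat_psum (e ` A) (\<lambda>n. x (inv_into A e n))"
proof -
  have c: "countable A" using assms by (auto simp: countable_def)
  let ?f = "\<lambda>n. e (from_nat_into A n)"
  have im: "?f ` (to_nat_on A ` A) = e ` A" using c by (auto simp: image_image)
  have inj: "inj_on ?f (to_nat_on A ` A)" using c assms by (auto simp: inj_on_def)
  have "nat_psum (e ` A) (\<lambda>n. x (inv_into A e n))
      = nat_psum (to_nat_on A ` A) (\<lambda>n. x (inv_into A e (?f n)))"
    using nat_psum_reindex[OF inj] im by simp
  also have "\<dots> = nat_psum (to_nat_on A ` A) (\<lambda>n. x (from_nat_into A n))"
    using c assms by (intro nat_psum_cong) auto
  finally show ?thesis using c by (simp add: psum_def)
qed

lemma psum_nat: "psum A x = nat_psum A x"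
proof -
  have "psum A x = nat_psum (id ` A) (\<lambda>n. x (inv_into A id n))" by (rule psum_inj) simp
  also have "\<dots> = nat_psum A x"
    using inv_into_f_f[of id A] by (simp, intro nat_psum_cong) auto
  finally show ?thesis .
qed

lemma psum_cong: "(\<And>a. a \<in> A \<Longrightarrow> x a = y a) \<Longrightarrow> psum A x = psum A y"
  unfolding psum_def by (auto intro!: nat_psum_cong)

lemma psum_image_nat:
  fixes e :: "'i \<Rightarrow> nat"
  assumes "inj_on e A"
  shows "nat_psum (e ` A) z = psum A (\<lambda>a. z (e a))"
  unfolding psum_inj[OF assms] by (intro nat_psum_cong) (simp add: f_inv_into_f)

lemma psum_reindex:
  assumes "inj_on f A"
  shows "psum (f ` A) x = psum A (\<lambda>a. x (f a))"
proof (cases "countable A")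
  case True
  define e where "e = to_nat_on (f ` A)"
  have e: "inj_on e (f ` A)" using True inj_on_to_nat_on by (auto simp: e_def)
  then have ef: "inj_on (\<lambda>a. e (f a)) A" using assms comp_inj_on[of f A e] by (simp add: o_def)
  have "psum (f ` A) x = nat_psum ((\<lambda>a. e (f a)) ` A) (\<lambda>n. x (inv_into (f ` A) e n))"
    using psum_inj[OF e] by (simp add: image_image)
  also have "\<dots> = psum A (\<lambda>a. x (inv_into (f ` A) e (e (f a))))"
    by (rule psum_image_nat[OF ef])
  also have "\<dots> = psum A (\<lambda>a. x (f a))"
    using e by (intro psum_cong) auto
  finally show ?thesis .
next
  case False
  then have "\<not> countable (f ` A)" using assms countable_image_inj_on by blast
  with False show ?thesis by (simp add: psum_def)
qed

lemma psum_unary: "psum {a} x = Some (x a)"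
  using psum_inj[of "\<lambda>_. 0" "{a}" x] by (simp add: nat_psum_unary inv_into_def)

lemma psum_wpa:
  assumes s: "psum A x = Some s" and D: "disjoint_family_on D I" "(\<Union>i\<in>I. D i) = A"
    and I: "countable I"
  shows "\<exists>t. (\<forall>i\<in>I. psum (D i) x = Some (t i)) \<and> psum I t = Some s"
proof -
  have A: "countable A" using s by (simp add: psum_def split: if_splits)
  define e where "e = to_nat_on A"
  define h where "h = to_nat_on I"
  have e: "inj_on e A" using A inj_on_to_nat_on by (auto simp: e_def)
  have h: "inj_on h I" using I inj_on_to_nat_on by (auto simp: h_def)
  define x' where "x' = (\<lambda>n. x (inv_into A e n))"
  define D' where "D' = (\<lambda>n. e ` D (inv_into I h n))"
  have "nat_psum (e ` A) x' = Some s" using s unfolding psum_inj[OF e] x'_def .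
  moreover have "disjoint_family_on D' (h ` I)"
    unfolding disjoint_family_on_def
  proof (intro ballI impI)
    fix m n assume "m \<in> h ` I" "n \<in> h ` I" "m \<noteq> n"
    then obtain i j where ij: "i \<in> I" "j \<in> I" "m = h i" "n = h j" "i \<noteq> j" by auto
    then have "D i \<inter> D j = {}" using D(1) by (auto simp: disjoint_family_on_def)
    moreover have "D i \<subseteq> A" "D j \<subseteq> A" using ij D(2) by auto
    ultimately have "e ` D i \<inter> e ` D j = {}" by (metis e inj_on_image_Int image_empty)
    then show "D' m \<inter> D' n = {}" using ij h by (simp add: D'_def)
  qed
  moreover have "(\<Union>n\<in>h ` I. D' n) = e ` A" using D(2) h by (auto simp: D'_def)
  ultimately have "\<exists>t. (\<forall>n\<in>h ` I. nat_psum (D' n) x' = Some (t n)) \<and> nat_psum (h ` I) t = Some s"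
    by (rule nat_psum_wpa)
  then obtain t where t: "\<forall>n\<in>h ` I. nat_psum (D' n) x' = Some (t n)" "nat_psum (h ` I) t = Some s"
    by blast
  have "psum (D i) x = Some (t (h i))" if i: "i \<in> I" for i
  proof -
    have sub: "D i \<subseteq> A" using i D(2) by auto
    have "nat_psum (e ` D i) x' = psum (D i) (\<lambda>a. x' (e a))"
      by (rule psum_image_nat[OF inj_on_subset[OF e sub]])
    also have "\<dots> = psum (D i) x"
      using sub e by (intro psum_cong) (auto simp: x'_def subset_iff)
    finally show ?thesis using bspec[OF t(1), of "h i"] i h by (simp add: D'_def)
  qed
  moreover have "psum I (\<lambda>i. t (h i)) = Some s" using t(2) unfolding psum_image_nat[OF h] .
  ultimately show ?thesis by (intro exI[of _ "\<lambda>i. t (h i)"] conjI ballI)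
qed

lemma psum_pa:
  fixes x :: "'i \<Rightarrow> 'r::strong_pcm"
  assumes D: "disjoint_family_on D I"
    and sums: "\<forall>i\<in>I. psum (D i) x = Some (t i)" and total: "psum I t \<noteq> None"
  shows "psum (\<Union>i\<in>I. D i) x \<noteq> None"
proof -
  let ?A = "\<Union>i\<in>I. D i"
  have I: "countable I" using total by (auto simp: psum_def split: if_splits)
  have "countable (D i)" if "i \<in> I" for i
    using sums that by (auto simp: psum_def split: if_splits)
  then have A: "countable ?A" using I by auto
  define e where "e = to_nat_on ?A"
  define h where "h = to_nat_on I"
  have e: "inj_on e ?A" using A inj_on_to_nat_on by (auto simp: e_def)
  have h: "inj_on h I" using I inj_on_to_nat_on by (auto simp: h_def)
  define x' where "x' = (\<lambda>n. x (inv_into ?A e n))"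
  define D' where "D' = (\<lambda>n. e ` D (inv_into I h n))"
  define t' where "t' = (\<lambda>n. t (inv_into I h n))"
  have "disjoint_family_on D' (h ` I)"
    unfolding disjoint_family_on_def
  proof (intro ballI impI)
    fix m n assume "m \<in> h ` I" "n \<in> h ` I" "m \<noteq> n"
    then obtain i j where ij: "i \<in> I" "j \<in> I" "m = h i" "n = h j" "i \<noteq> j" by auto
    then have "D i \<inter> D j = {}" using D by (auto simp: disjoint_family_on_def)
    moreover have "D i \<subseteq> ?A" "D j \<subseteq> ?A" using ij by auto
    ultimately have "e ` D i \<inter> e ` D j = {}" by (metis e inj_on_image_Int image_empty)
    then show "D' m \<inter> D' n = {}" using ij h by (simp add: D'_def)
  qed
  moreover have "\<forall>n\<in>h ` I. nat_psum (D' n) x' = Some (t' n)"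
  proof
    fix n assume "n \<in> h ` I"
    then obtain i where i: "i \<in> I" "n = h i" by auto
    have sub: "D i \<subseteq> ?A" using i by auto
    have "nat_psum (e ` D i) x' = psum (D i) (\<lambda>a. x' (e a))"
      by (rule psum_image_nat[OF inj_on_subset[OF e sub]])
    also have "\<dots> = psum (D i) x"
    proof (rule psum_cong)
      fix a assume "a \<in> D i"
      then have "inv_into ?A e (e a) = a" using sub by (intro inv_into_f_f[OF e]) blast
      then show "x' (e a) = x a" by (simp add: x'_def)
    qed
    finally show "nat_psum (D' n) x' = Some (t' n)" using sums i h by (simp add: D'_def t'_def)
  qed
  moreover have "nat_psum (h ` I) t' \<noteq> None" using total unfolding psum_inj[OF h] t'_def .
  ultimately have "nat_psum (\<Union>n\<in>h ` I. D' n) x' \<noteq> None" by (rule nat_psum_pa)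
  moreover have "(\<Union>n\<in>h ` I. D' n) = e ` ?A" using h by (auto simp: D'_def)
  ultimately show ?thesis unfolding psum_inj[OF e] x'_def by simp
qed

lemma psum_times:
  fixes x :: "'i \<Rightarrow> 'r::pcr" and y :: "'j \<Rightarrow> 'r"
  assumes x: "psum A x = Some s" and y: "psum B y = Some t"
  shows "psum (A \<times> B) (\<lambda>(a, b). x a * y b) = Some (s * t)"
proof -
  have A: "countable A" using x by (simp add: psum_def split: if_splits)
  have B: "countable B" using y by (simp add: psum_def split: if_splits)
  define e where "e = to_nat_on A"
  define h where "h = to_nat_on B"
  have e: "inj_on e A" using A inj_on_to_nat_on by (auto simp: e_def)
  have h: "inj_on h B" using B inj_on_to_nat_on by (auto simp: h_def)
  have "psum ((e ` A) \<times> (h ` B)) (\<lambda>(m, n). x (inv_into A e m) * y (inv_into B h n)) = Some (s * t)"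
    using x y by (intro nat_psum_times) (simp_all add: psum_inj[OF e] psum_inj[OF h])
  moreover have "(e ` A) \<times> (h ` B) = map_prod e h ` (A \<times> B)" by (rule map_prod_surj_on[symmetric]) auto
  moreover have "inj_on (map_prod e h) (A \<times> B)" by (rule map_prod_inj_on[OF e h])
  ultimately have "psum (A \<times> B) (\<lambda>p. case map_prod e h p of
      (m, n) \<Rightarrow> x (inv_into A e m) * y (inv_into B h n)) = Some (s * t)"
    by (simp add: psum_reindex)
  moreover have "psum (A \<times> B) (\<lambda>p. case map_prod e h p of
      (m, n) \<Rightarrow> x (inv_into A e m) * y (inv_into B h n)) = psum (A \<times> B) (\<lambda>(a, b). x a * y b)"
    using e h by (intro psum_cong) auto
  ultimately show ?thesis by simp
qed

text \<open>
  The set of vectors over a web \<open>W\<close> is \<open>extensional W\<close>: functions with the fixed value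
  \<open>undefined\<close> outside \<open>W\<close>, so that each \<open>W\<close>-indexed family is represented exactly once (the empty
  web included).
\<close>

definition pairing :: "'i set \<Rightarrow> ('i \<Rightarrow> 'r::pcr) \<Rightarrow> ('i \<Rightarrow> 'r) \<Rightarrow> 'r option" where
  "pairing W x y = psum W (\<lambda>a. x a * y a)"

definition orth :: "'r::pcr set \<Rightarrow> 'i set \<Rightarrow> ('i \<Rightarrow> 'r) \<Rightarrow> ('i \<Rightarrow> 'r) \<Rightarrow> bool" where
  "orth B W x y \<longleftrightarrow> (\<exists>r. pairing W x y = Some r \<and> r \<in> B)"

definition perp :: "'r::pcr set \<Rightarrow> 'i set \<Rightarrow> ('i \<Rightarrow> 'r) set \<Rightarrow> ('i \<Rightarrow> 'r) set" where
  "perp B W F = {y \<in> extensional W. \<forall>x\<in>F. orth B W x y}"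

definition covering :: "'i set \<Rightarrow> ('i \<Rightarrow> 'r::pcr) set \<Rightarrow> bool" where
  "covering W F \<longleftrightarrow> F \<subseteq> extensional W \<and> (\<forall>a\<in>W. \<exists>x\<in>F. \<exists>u. x a * u = 1)"

record ('i, 'r) prespace =
  web :: "'i set"
  vecs :: "('i \<Rightarrow> 'r) set"

definition is_space :: "'r::pcr set \<Rightarrow> ('i, 'r) prespace \<Rightarrow> bool" where
  "is_space B X \<longleftrightarrow> countable (web X) \<and> vecs X \<subseteq> extensional (web X) \<and>
     perp B (web X) (perp B (web X) (vecs X)) = vecs X \<and>
     covering (web X) (vecs X) \<and> covering (web X) (perp B (web X) (vecs X))"

definition dual :: "'r::pcr set \<Rightarrow> ('i, 'r) prespace \<Rightarrow> ('i, 'r) prespace" where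
  "dual B X = \<lparr>web = web X, vecs = perp B (web X) (vecs X)\<rparr>"

definition tensor_vec :: "'i set \<Rightarrow> 'j set \<Rightarrow> ('i \<Rightarrow> 'r::pcr) \<Rightarrow> ('j \<Rightarrow> 'r) \<Rightarrow> ('i \<times> 'j \<Rightarrow> 'r)" where
  "tensor_vec V W x y = (\<lambda>(a, b)\<in>V \<times> W. x a * y b)"

definition tensor_set ::
  "'i set \<Rightarrow> 'j set \<Rightarrow> ('i \<Rightarrow> 'r::pcr) set \<Rightarrow> ('j \<Rightarrow> 'r) set \<Rightarrow> ('i \<times> 'j \<Rightarrow> 'r) set" where
  "tensor_set V W F G = {tensor_vec V W x y | x y. x \<in> F \<and> y \<in> G}"

definition tensor ::
  "'r::pcr set \<Rightarrow> ('i, 'r) prespace \<Rightarrow> ('j, 'r) prespace \<Rightarrow> ('i \<times> 'j, 'r) prespace" where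
  "tensor B X Y = \<lparr>web = web X \<times> web Y,
     vecs = perp B (web X \<times> web Y) (perp B (web X \<times> web Y)
              (tensor_set (web X) (web Y) (vecs X) (vecs Y)))\<rparr>"

definition lolli ::
  "'r::pcr set \<Rightarrow> ('i, 'r) prespace \<Rightarrow> ('j, 'r) prespace \<Rightarrow> ('i \<times> 'j, 'r) prespace" where
  "lolli B X Y = dual B (tensor B X (dual B Y))"

definition mat_app ::
  "'i set \<Rightarrow> 'j set \<Rightarrow> ('i \<times> 'j \<Rightarrow> 'r::pcr) \<Rightarrow> ('i \<Rightarrow> 'r) \<Rightarrow> ('j \<Rightarrow> 'r) option" where
  "mat_app V W s x =
     (if \<forall>b\<in>W. psum V (\<lambda>a. s (a, b) * x a) \<noteq> None
      then Some (\<lambda>b\<in>W. the (psum V (\<lambda>a. s (a, b) * x a))) else None)"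

definition mat_transpose :: "'i set \<Rightarrow> 'j set \<Rightarrow> ('i \<times> 'j \<Rightarrow> 'r) \<Rightarrow> ('j \<times> 'i \<Rightarrow> 'r)" where
  "mat_transpose V W s = (\<lambda>(b, a)\<in>W \<times> V. s (a, b))"

end

(*
  Proof idea.  Partition associativity turns the double sum over |X| * |Y| into an iterated one, so
  x \<otimes> y is orthogonal to s iff s x is orthogonal to y, as soon as s x is defined; when y ranges
  over a covering, definedness is automatic, because an invertible y_b can be cancelled from the
  section at b of the double sum.  Hence (F \<otimes> G)^perp depends on the covering G only through
  G^perp, and by transposition on the covering F only through F^perp.  Replacing first G and then F
  by their biorthogonals links (1) and (2).
*)
theory Submission
  imports Defs
begin

text \<open>Partition the product into the sections \<open>V \<times> {b}\<close>, each a reindexed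
  copy of \<open>V\<close>. Countability of \<open>W\<close> is a separate hypothesis because an
  empty \<open>V\<close> makes the product countable whatever \<open>W\<close> is.\<close>

lemma psum_Times_iterated:
  fixes f :: "'i \<times> 'j \<Rightarrow> 'r::pcm"
  assumes "psum (V \<times> W) f = Some r" and "countable W"
  shows "\<exists>t. (\<forall>b\<in>W. psum V (\<lambda>a. f (a, b)) = Some (t b)) \<and> psum W t = Some r"
proof -
  have "\<exists>t. (\<forall>b\<in>W. psum (V \<times> {b}) f = Some (t b)) \<and> psum W t = Some r"
    by (rule psum_wpa[OF assms(1) _ _ assms(2)]) (auto simp: disjoint_family_on_def)
  moreover have "psum (V \<times> {b}) f = psum V (\<lambda>a. f (a, b))" for b
  proof -
    have "V \<times> {b} = (\<lambda>a. (a, b)) ` V" by auto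
    then show ?thesis by (simp add: psum_reindex inj_on_def)
  qed
  ultimately show ?thesis by simp
qed

text \<open>Converse of \<open>psum_Times_iterated\<close>, and the place where strongness enters:
  \<open>psum_pa\<close> yields summability of the double family.\<close>

lemma psum_iterated_Times:
  fixes f :: "'i \<times> 'j \<Rightarrow> 'r::strong_pcm"
  assumes t: "\<And>b. b \<in> W \<Longrightarrow> psum V (\<lambda>a. f (a, b)) = Some (t b)" and r: "psum W t = Some r"
  shows "psum (V \<times> W) f = Some r"
proof -
  have W: "countable W" using r by (simp add: psum_def split: if_splits)
  have sections: "psum (V \<times> {b}) f = Some (t b)" if "b \<in> W" for b
  proof -
    have "V \<times> {b} = (\<lambda>a. (a, b)) ` V" by auto
    then show ?thesis using t[OF that] by (simp add: psum_reindex inj_on_def)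
  qed
  have "psum (\<Union>b\<in>W. V \<times> {b}) f \<noteq> None"
    using sections r by (intro psum_pa[where t = t]) (auto simp: disjoint_family_on_def)
  moreover have "(\<Union>b\<in>W. V \<times> {b}) = V \<times> W" by auto
  \<comment> \<open>Only existence of the sum is known so far. Splitting it again into sections
    identifies its value, since the section sums are unique.\<close>
  ultimately obtain r' where r': "psum (V \<times> W) f = Some r'" by auto
  then obtain t' where t': "\<forall>b\<in>W. psum V (\<lambda>a. f (a, b)) = Some (t' b)" "psum W t' = Some r'"
    using psum_Times_iterated[OF _ W] by blast
  have "psum W t' = psum W t" using t t'(1) by (intro psum_cong) simp
  then show ?thesis using r r' t'(2) by simp
qed

text \<open>The scalar \<open>c\<close> is the sum of a one-element family, so this is
  distributivity over \<open>A \<times> {()}\<close>.\<close>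

lemma psum_mult_right:
  fixes x :: "'i \<Rightarrow> 'r::pcr"
  assumes "psum A x = Some s"
  shows "psum A (\<lambda>a. x a * c) = Some (s * c)"
proof -
  have "psum (A \<times> {()}) (\<lambda>(a, b). x a * c) = Some (s * c)"
    by (rule psum_times[OF assms]) (rule psum_unary)
  moreover have "A \<times> {()} = (\<lambda>a. (a, ())) ` A" by auto
  ultimately show ?thesis by (simp add: psum_reindex inj_on_def)
qed

text \<open>Scaling by the inverse \<open>u\<close> undoes scaling by \<open>c\<close>, so
  summability can be pulled back through an invertible factor.\<close>

lemma psum_mult_right_invertible:
  fixes x :: "'i \<Rightarrow> 'r::pcr"
  assumes "psum A (\<lambda>a. x a * c) = Some s" and "c * u = 1"
  shows "psum A x = Some (s * u)"
  using psum_mult_right[OF assms(1), of u] assms(2) by (simp add: mult.assoc)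

lemma orth_sym: "orth B W x y \<longleftrightarrow> orth B W y x"
  by (simp add: orth_def pairing_def mult.commute)

lemma perp_antimono: "F \<subseteq> G \<Longrightarrow> perp B W G \<subseteq> perp B W F"
  by (auto simp: perp_def)

lemma subset_perp_perp: "F \<subseteq> extensional W \<Longrightarrow> F \<subseteq> perp B W (perp B W F)"
  by (auto simp: perp_def orth_sym)

lemma perp_perp_perp:
  assumes "F \<subseteq> extensional W"
  shows "perp B W (perp B W (perp B W F)) = perp B W F"
proof
  show "perp B W (perp B W (perp B W F)) \<subseteq> perp B W F"
    by (rule perp_antimono[OF subset_perp_perp[OF assms]])
  show "perp B W F \<subseteq> perp B W (perp B W (perp B W F))"
    by (rule subset_perp_perp) (auto simp: perp_def)
qed

lemma tensor_set_extensional: "tensor_set V W F G \<subseteq> extensional (V \<times> W)"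
  by (auto simp: tensor_set_def tensor_vec_def)

text \<open>The factors are ordered so that \<open>s (a, b) * x a\<close> is the summand of
  \<open>mat_app\<close> and \<open>y b\<close>, constant on the section at \<open>b\<close>, stands
  on the right.\<close>

lemma pairing_tensor_vec:
  "pairing (V \<times> W) (tensor_vec V W x y) s = psum (V \<times> W) (\<lambda>(a, b). s (a, b) * x a * y b)"
  unfolding pairing_def
  by (intro psum_cong) (auto simp: tensor_vec_def mult.commute mult.left_commute)

text \<open>An equality of partial values: either side is defined as soon as the other is. From
  right to left this rests on the strong axiom, from left to right on weak partition
  associativity.\<close>

lemma pairing_mat_app:
  fixes s :: "'i \<times> 'j \<Rightarrow> 'r::strong_pcr"
  assumes z: "mat_app V W s x = Some z" and W: "countable W"
  shows "pairing (V \<times> W) (tensor_vec V W x y) s = pairing W y z"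
proof -
  have sums: "psum V (\<lambda>a. s (a, b) * x a) = Some (z b)" if "b \<in> W" for b
    using z that by (auto simp: mat_app_def split: if_splits)
  have sections: "psum V (\<lambda>a. s (a, b) * x a * y b) = Some (z b * y b)" if "b \<in> W" for b
    by (rule psum_mult_right[OF sums[OF that]])
  let ?f = "\<lambda>(a, b). s (a, b) * x a * y b"
  have "psum (V \<times> W) ?f = Some r" if "psum W (\<lambda>b. z b * y b) = Some r" for r
    by (rule psum_iterated_Times[OF _ that]) (simp add: sections)
  moreover have "psum W (\<lambda>b. z b * y b) = Some r" if "psum (V \<times> W) ?f = Some r" for r
  proof -
    from psum_Times_iterated[OF that W]
    obtain t where t: "\<forall>b\<in>W. psum V (\<lambda>a. s (a, b) * x a * y b) = Some (t b)" "psum W t = Some r"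
      unfolding prod.case by blast
    have "psum W (\<lambda>b. z b * y b) = psum W t" using t(1) sections by (intro psum_cong) simp
    then show ?thesis using t(2) by simp
  qed
  ultimately have "psum (V \<times> W) ?f = psum W (\<lambda>b. z b * y b)"
    by (cases "psum (V \<times> W) ?f"; cases "psum W (\<lambda>b. z b * y b)") simp_all
  then show ?thesis unfolding pairing_tensor_vec by (simp add: pairing_def mult.commute)
qed

text \<open>For each \<open>b\<close> the covering supplies a \<open>y\<close> with
  \<open>y b\<close> invertible. The section at \<open>b\<close> of the double sum for this
  \<open>y\<close> is the component of \<open>s x\<close> at \<open>b\<close> scaled by
  \<open>y b\<close>, which cancels.\<close>

lemma mat_app_defined:
  fixes s :: "'i \<times> 'j \<Rightarrow> 'r::pcr"
  assumes G: "covering W G" and W: "countable W"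
    and defined: "\<And>y. y \<in> G \<Longrightarrow> pairing (V \<times> W) (tensor_vec V W x y) s \<noteq> None"
  shows "mat_app V W s x \<noteq> None"
proof -
  have "psum V (\<lambda>a. s (a, b) * x a) \<noteq> None" if b: "b \<in> W" for b
  proof -
    obtain y u where y: "y \<in> G" "y b * u = 1" using G b by (auto simp: covering_def)
    obtain r where "psum (V \<times> W) (\<lambda>(a, b). s (a, b) * x a * y b) = Some r"
      using defined[OF y(1)] by (auto simp: pairing_tensor_vec)
    from psum_Times_iterated[OF this W] b
    obtain c where "psum V (\<lambda>a. s (a, b) * x a * y b) = Some c" by auto
    from psum_mult_right_invertible[OF this y(2)] show ?thesis by simp
  qed
  then show ?thesis by (simp add: mat_app_def)
qed

lemma mem_perp_tensor_set_iff:
  assumes "s \<in> extensional (V \<times> W)"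
  shows "s \<in> perp B (V \<times> W) (tensor_set V W F G)
    \<longleftrightarrow> (\<forall>x\<in>F. \<forall>y\<in>G. orth B (V \<times> W) (tensor_vec V W x y) s)"
  using assms unfolding perp_def tensor_set_def by blast

text \<open>This is (2) iff (3), and (2) iff (4) when applied to the transposed matrix. The
  equivalence already holds for each \<open>x\<close> separately.\<close>

lemma perp_tensor_set_iff_mat_app:
  fixes s :: "'i \<times> 'j \<Rightarrow> 'r::strong_pcr"
  assumes G: "covering W G" and W: "countable W" and s: "s \<in> extensional (V \<times> W)"
  shows "s \<in> perp B (V \<times> W) (tensor_set V W F G)
    \<longleftrightarrow> (\<forall>x\<in>F. \<exists>z. mat_app V W s x = Some z \<and> z \<in> perp B W G)"
proof -
  have "(\<forall>y\<in>G. orth B (V \<times> W) (tensor_vec V W x y) s)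
      \<longleftrightarrow> (\<exists>z. mat_app V W s x = Some z \<and> z \<in> perp B W G)" for x
  proof (cases "mat_app V W s x")
    case None
    \<comment> \<open>By contraposition of \<open>mat_app_defined\<close>, some \<open>y\<close> in
      the covering has an undefined pairing, so orthogonality fails too.\<close>
    then obtain y where "y \<in> G" "pairing (V \<times> W) (tensor_vec V W x y) s = None"
      using mat_app_defined[OF G W] by blast
    then have "\<not> orth B (V \<times> W) (tensor_vec V W x y) s" by (simp add: orth_def)
    then show ?thesis using None \<open>y \<in> G\<close> by auto
  next
    case (Some z)
    then have "z \<in> extensional W" by (auto simp: mat_app_def split: if_splits)
    then show ?thesis using Some by (simp add: perp_def orth_def pairing_mat_app[OF Some W])
  qed
  then show ?thesis by (simp add: mem_perp_tensor_set_iff[OF s])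
qed

lemma mat_transpose_extensional: "mat_transpose V W s \<in> extensional (W \<times> V)"
  by (simp add: mat_transpose_def)

lemma pairing_mat_transpose:
  "pairing (W \<times> V) (tensor_vec W V y x) (mat_transpose V W s)
     = pairing (V \<times> W) (tensor_vec V W x y) s"
proof -
  have "W \<times> V = prod.swap ` (V \<times> W)" by (simp add: product_swap)
  then show ?thesis
    unfolding pairing_def
    by (simp add: psum_reindex del: product_swap, intro psum_cong)
      (auto simp: tensor_vec_def mat_transpose_def mult.commute)
qed

lemma perp_tensor_set_transpose:
  assumes "s \<in> extensional (V \<times> W)"
  shows "mat_transpose V W s \<in> perp B (W \<times> V) (tensor_set W V G F)
    \<longleftrightarrow> s \<in> perp B (V \<times> W) (tensor_set V W F G)"
  unfolding mem_perp_tensor_set_iff[OF assms] mem_perp_tensor_set_iff[OF mat_transpose_extensional]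
    orth_def pairing_mat_transpose by blast

text \<open>For a covering \<open>G\<close>, condition (3) mentions \<open>G\<close> only through
  \<open>perp B W G\<close>.\<close>

lemma perp_tensor_set_cong_right:
  fixes s :: "'i \<times> 'j \<Rightarrow> 'r::strong_pcr"
  assumes "covering W G" "covering W G'" "perp B W G = perp B W G'"
    and "countable W" "s \<in> extensional (V \<times> W)"
  shows "s \<in> perp B (V \<times> W) (tensor_set V W F G) \<longleftrightarrow> s \<in> perp B (V \<times> W) (tensor_set V W F G')"
  using assms by (simp add: perp_tensor_set_iff_mat_app)

lemma perp_tensor_set_cong_left:
  fixes s :: "'i \<times> 'j \<Rightarrow> 'r::strong_pcr"
  assumes "covering V F" "covering V F'" "perp B V F = perp B V F'"
    and "countable V" "s \<in> extensional (V \<times> W)"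
  shows "s \<in> perp B (V \<times> W) (tensor_set V W F G) \<longleftrightarrow> s \<in> perp B (V \<times> W) (tensor_set V W F' G)"
  using perp_tensor_set_cong_right[OF assms(1-4) mat_transpose_extensional, of W s G]
  by (simp add: perp_tensor_set_transpose assms(5))

text \<open>The biorthogonal closure in the tensor is absorbed by the outer orthogonal.\<close>

lemma vecs_lolli:
  "vecs (lolli B X Y)
     = perp B (web X \<times> web Y) (tensor_set (web X) (web Y) (vecs X) (perp B (web Y) (vecs Y)))"
  by (simp add: lolli_def tensor_def dual_def perp_perp_perp[OF tensor_set_extensional])

theorem theorem2p10:
  fixes B :: "'r::strong_pcr set"
    and X :: "('i, 'r) prespace" and Y :: "('j, 'r) prespace"
    and P :: "('i \<Rightarrow> 'r) set" and Q :: "('j \<Rightarrow> 'r) set"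
    and s :: "'i \<times> 'j \<Rightarrow> 'r"
  assumes "down_closed B"
    and "is_space B X" and "is_space B Y"
    and "covering (web X) P" and "covering (web Y) Q"
    and "perp B (web X) (perp B (web X) P) = vecs X"
    and "perp B (web Y) Q = vecs Y"
    and "s \<in> extensional (web X \<times> web Y)"
  shows "(s \<in> vecs (lolli B X Y)
            \<longleftrightarrow> s \<in> perp B (web X \<times> web Y) (tensor_set (web X) (web Y) P Q))
       \<and> (s \<in> vecs (lolli B X Y)
            \<longleftrightarrow> (\<forall>x\<in>P. \<exists>z. mat_app (web X) (web Y) s x = Some z \<and> z \<in> vecs Y))
       \<and> (s \<in> vecs (lolli B X Y)
            \<longleftrightarrow> (\<forall>y'\<in>Q. \<exists>z. mat_app (web Y) (web X) (mat_transpose (web X) (web Y) s) y' = Some z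
                   \<and> z \<in> perp B (web X) (vecs X)))"
proof -
  let ?V = "web X" and ?W = "web Y"
  have X: "countable ?V" "covering ?V (vecs X)" and Y: "countable ?W" "covering ?W (perp B ?W (vecs Y))"
    using assms(2,3) by (simp_all add: is_space_def)
  have ext: "P \<subseteq> extensional ?V" "Q \<subseteq> extensional ?W"
    using assms(4,5) by (simp_all add: covering_def)
  \<comment> \<open>Triple orthogonals collapse, so \<open>P\<close> and \<open>vecs X\<close> have
    the same orthogonal; likewise \<open>Q\<close> and the orthogonal of \<open>vecs Y\<close>
    below.\<close>
  have perpX: "perp B ?V (vecs X) = perp B ?V P"
    using perp_perp_perp[OF ext(1), of B] assms(6) by simp
  have perpY: "perp B ?W (perp B ?W (vecs Y)) = perp B ?W Q"
    using perp_perp_perp[OF ext(2), of B] assms(7) by simp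
  have "s \<in> vecs (lolli B X Y) \<longleftrightarrow> s \<in> perp B (?V \<times> ?W) (tensor_set ?V ?W (vecs X) Q)"
    unfolding vecs_lolli by (rule perp_tensor_set_cong_right[OF Y(2) assms(5) perpY Y(1) assms(8)])
  also have "\<dots> \<longleftrightarrow> s \<in> perp B (?V \<times> ?W) (tensor_set ?V ?W P Q)"
    by (rule perp_tensor_set_cong_left[OF X(2) assms(4) perpX X(1) assms(8)])
  finally have 12: "s \<in> vecs (lolli B X Y) \<longleftrightarrow> s \<in> perp B (?V \<times> ?W) (tensor_set ?V ?W P Q)" .
  \<comment> \<open>With (1) replaced by (2), condition (3) uses the covering \<open>Q\<close>,
    whose orthogonal is \<open>vecs Y\<close>. Condition (4) uses the transposed matrix and the
    covering \<open>P\<close>, whose orthogonal is that of \<open>vecs X\<close>.\<close>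
  show ?thesis
    unfolding 12 perpX assms(7)[symmetric]
    using perp_tensor_set_iff_mat_app[OF assms(5) Y(1) assms(8), of B P]
      perp_tensor_set_iff_mat_app[OF assms(4) X(1) mat_transpose_extensional, of ?W s B Q]
      perp_tensor_set_transpose[OF assms(8), of B Q P]
    by simp
qed

end
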